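(* Let $\Lambda_{HF}\subset\mathbb{R}$ be the Half-Fibonacci cut-and-project set and let $\mathbb{X}_{HF}$ be its hull. Then $\mathbb{X}_{HF}$ contains uncountably many bounded distance equivalence classes.
   Context: Let $\tau=(1+\sqrt5)/2$, and for $x=a+b\tau\in\mathbb{Z}[\tau]$ ($a,b\in\mathbb{Z}$) let $x^\star=a+b(1-\tau)$ be its algebraic conjugate. The Fibonacci cut-and-project set is $\{x\in\mathbb{Z}[\tau] \mid x^\star\in[-1,\tau-1)\}$, with window an interval of length $\tau$. The Half-Fibonacci cut-and-project set is obtained by using half of this window: $\Lambda_{HF}=\{x\in\mathbb{Z}[\tau] \mid x^\star\in[-1,-1+\tau/2)\}$. A Delone set in $\mathbb{R}$ is a set $\Lambda\subset\mathbb{R}$ for which there are $r>0$ and $R>0$ such that every open ball (interval) of radius $r$ contains at most one point of $\Lambda$ and every closed ball of radius $R$ contains at least one point of $\Lambda$. Two Delone sets $\Lambda,\Lambda'$ in $\mathbb{R}$ are bounded distance equivalent if there is a bijection $\phi:\Lambda\to\Lambda'$ such that $|x-\phi(x)|$ is uniformly bounded over $x\in\Lambda$. This is an equivalence relation; the bounded distance equivalence classes in the hull are the classes of this relation restricted to the hull. Hull: define the distance of two Delone sets $\Lambda,\Lambda'$ as the infimum of all $\varepsilon\in(0,1)$ for which there exist $x,x'\in\mathbb{R}$ with $|x|,|x'|\le\varepsilon/2$ such that $\Lambda-x$ and $\Lambda'-x'$ agree exactly on the ball of radius $1/\varepsilon$ about the origin, and as $1$ if no such $\varepsilon$ exists.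 The hull of $\Lambda$ is the closure, in the resulting topology on Delone sets, of the translation orbit $\{\Lambda-x \mid x\in\mathbb{R}\}$. *)

theory Defs
  imports "HOL-Analysis.Analysis" "HOL-Computational_Algebra.Primes"
begin

definition delone :: "real set \<Rightarrow> bool" where
  "delone \<Lambda> \<longleftrightarrow> (\<exists>r>0. \<exists>R>0.
     (\<forall>c. \<forall>x\<in>\<Lambda> \<inter> ball c r. \<forall>y\<in>\<Lambda> \<inter> ball c r. x = y) \<and>
     (\<forall>c. \<Lambda> \<inter> cball c R \<noteq> {}))"

definition translate :: "real set \<Rightarrow> real \<Rightarrow> real set" where
  "translate \<Lambda> x = (\<lambda>y. y - x) ` \<Lambda>"

text \<open>
  Taking open balls instead of the closed ones below would not change the infimum
  in \<open>delone_dist\<close>.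
\<close>

definition close_within :: "real set \<Rightarrow> real set \<Rightarrow> real \<Rightarrow> bool" where
  "close_within \<Lambda> \<Lambda>' \<epsilon> \<longleftrightarrow> (\<exists>x x'. \<bar>x\<bar> \<le> \<epsilon> / 2 \<and> \<bar>x'\<bar> \<le> \<epsilon> / 2 \<and>
     translate \<Lambda> x \<inter> cball 0 (1 / \<epsilon>) = translate \<Lambda>' x' \<inter> cball 0 (1 / \<epsilon>))"

definition delone_dist :: "real set \<Rightarrow> real set \<Rightarrow> real" where
  "delone_dist \<Lambda> \<Lambda>' =
     (if \<exists>\<epsilon>\<in>{0<..<1}. close_within \<Lambda> \<Lambda>' \<epsilon>
      then Inf {\<epsilon>\<in>{0<..<1}. close_within \<Lambda> \<Lambda>' \<epsilon>} else 1)"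

lemma mem_translate: "y \<in> translate \<Lambda> x \<longleftrightarrow> y + x \<in> \<Lambda>"
  unfolding translate_def by (auto simp: image_iff algebra_simps intro: bexI[of _ "y + x"])

lemma close_within_sym: "close_within A B \<epsilon> \<Longrightarrow> close_within B A \<epsilon>"
  unfolding close_within_def by metis

lemma close_within_triangle:
  assumes "close_within A B e" "close_within B C f" "e > 0" "f > 0" "e + f < 1"
  shows "close_within A C (e + f)"
proof -
  obtain x x' where x: "\<bar>x\<bar> \<le> e / 2" "\<bar>x'\<bar> \<le> e / 2"
    and AB: "translate A x \<inter> cball 0 (1 / e) = translate B x' \<inter> cball 0 (1 / e)"
    using assms(1) unfolding close_within_def by blast
  obtain y y' where y: "\<bar>y\<bar> \<le> f / 2" "\<bar>y'\<bar> \<le> f / 2"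
    and BC: "translate B y \<inter> cball 0 (1 / f) = translate C y' \<inter> cball 0 (1 / f)"
    using assms(2) unfolding close_within_def by blast
  have radius: "1 / (s + t) + t / 2 \<le> 1 / s" if "s > 0" "t > 0" "s + t < 1" for s t :: real
  proof -
    have "s * (s + t) \<le> 1 * 1" using that by (intro mult_mono) auto
    then have "t * (s * (s + t)) \<le> t * 2" using that by (intro mult_left_mono) auto
    then show ?thesis using that by (simp add: field_simps)
  qed
  have "z \<in> translate A (x + y) \<longleftrightarrow> z \<in> translate C (x' + y')"
    if z: "\<bar>z\<bar> \<le> 1 / (e + f)" for z
  proof -
    have "\<bar>z + y\<bar> \<le> 1 / e" using radius[of e f] assms z y by linarith
    then have 1: "z + y + x \<in> A \<longleftrightarrow> z + y + x' \<in> B"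
      using AB by (auto simp: set_eq_iff mem_translate)
    have "\<bar>z + x'\<bar> \<le> 1 / f" using radius[of f e] assms z x by (simp add: add.commute)
    then have 2: "z + x' + y \<in> B \<longleftrightarrow> z + x' + y' \<in> C"
      using BC by (auto simp: set_eq_iff mem_translate)
    show ?thesis using 1 2 by (simp add: mem_translate algebra_simps)
  qed
  then have "translate A (x + y) \<inter> cball 0 (1 / (e + f)) =
             translate C (x' + y') \<inter> cball 0 (1 / (e + f))"
    by auto
  moreover have "\<bar>x + y\<bar> \<le> (e + f) / 2" "\<bar>x' + y'\<bar> \<le> (e + f) / 2" using x y by argo+
  ultimately show ?thesis unfolding close_within_def by blast
qed

lemma bdd_below_unit_interval: "bdd_below {\<epsilon>\<in>{0<..<1::real}. P \<epsilon>}"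
  by (rule bdd_belowI[of _ 0]) auto

lemma delone_dist_le:
  "close_within A B \<epsilon> \<Longrightarrow> 0 < \<epsilon> \<Longrightarrow> \<epsilon> < 1 \<Longrightarrow> delone_dist A B \<le> \<epsilon>"
  using cInf_lower[OF _ bdd_below_unit_interval, of \<epsilon> "close_within A B"]
  by (auto simp: delone_dist_def)

lemma delone_dist_nonneg: "0 \<le> delone_dist A B"
  unfolding delone_dist_def by (auto intro!: cInf_greatest)

lemma delone_dist_le_1: "delone_dist A B \<le> 1"
proof (cases "\<exists>\<epsilon>\<in>{0<..<1}. close_within A B \<epsilon>")
  case True
  then show ?thesis using delone_dist_le by fastforce
qed (simp add: delone_dist_def)

lemma delone_dist_lessD:
  assumes "delone_dist A B < e" "e \<le> 1"
  obtains \<epsilon> where "0 < \<epsilon>" "\<epsilon> < e" "close_within A B \<epsilon>"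
proof -
  have *: "\<exists>\<epsilon>\<in>{0<..<1}. close_within A B \<epsilon>"
    using assms by (auto simp: delone_dist_def split: if_splits)
  then have "Inf {\<epsilon>\<in>{0<..<1}. close_within A B \<epsilon>} < e"
    using assms by (simp add: delone_dist_def)
  moreover have "{\<epsilon>\<in>{0<..<1}. close_within A B \<epsilon>} \<noteq> {}" using * by blast
  ultimately obtain \<epsilon> where "\<epsilon> \<in> {\<epsilon>\<in>{0<..<1}. close_within A B \<epsilon>}" "\<epsilon> < e"
    using cInf_lessD by metis
  then show ?thesis by (intro that) auto
qed

lemma delone_dist_zero_subset:
  assumes "delone B" "delone_dist A B = 0"
  shows "A \<subseteq> B"
proof
  fix a assume a: "a \<in> A"
  obtain r where r: "r > 0"
    "\<And>c x y. x \<in> B \<Longrightarrow> y \<in> B \<Longrightarrow> x \<in> ball c r \<Longrightarrow> y \<in> ball c r \<Longrightarrow> x = y"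
    using assms(1) unfolding delone_def by blast
  have near: "\<exists>b\<in>B. \<bar>a - b\<bar> < e" if e: "e > 0" for e
  proof -
    define m where "m = Min {1, e, 1 / (\<bar>a\<bar> + 1)}"
    have m: "0 < m" "m \<le> 1" "m \<le> e" "m \<le> 1 / (\<bar>a\<bar> + 1)" using e by (auto simp: m_def)
    obtain \<epsilon> where \<epsilon>: "0 < \<epsilon>" "\<epsilon> < m" "close_within A B \<epsilon>"
      using delone_dist_lessD[of A B m] assms(2) m by auto
    obtain x x' where x: "\<bar>x\<bar> \<le> \<epsilon> / 2" "\<bar>x'\<bar> \<le> \<epsilon> / 2"
      and AB: "translate A x \<inter> cball 0 (1 / \<epsilon>) = translate B x' \<inter> cball 0 (1 / \<epsilon>)"
      using \<epsilon>(3) unfolding close_within_def by blast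
    have "\<epsilon> \<le> 1 / (\<bar>a\<bar> + 1)" using \<epsilon> m by linarith
    then have "\<bar>a\<bar> + 1 \<le> 1 / \<epsilon>" using \<epsilon>(1) by (simp add: field_simps)
    then have "\<bar>a - x\<bar> \<le> 1 / \<epsilon>" using x \<epsilon> m by linarith
    then have "a - x \<in> translate A x \<inter> cball 0 (1 / \<epsilon>)" using a by (simp add: mem_translate)
    then have "a - x + x' \<in> B" unfolding AB by (simp add: mem_translate)
    moreover have "\<bar>a - (a - x + x')\<bar> < e" using x \<epsilon> m by linarith
    ultimately show ?thesis by blast
  qed
  obtain b where b: "b \<in> B" "\<bar>a - b\<bar> < r" using near[OF r(1)] by blast
  have "a = b"
  proof (rule ccontr)
    assume "a \<noteq> b"
    then obtain c where c: "c \<in> B" "\<bar>a - c\<bar> < min r \<bar>a - b\<bar>"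
      using near[of "min r \<bar>a - b\<bar>"] r(1) by auto
    then have "c = b" using r(2)[of c b a] b by (auto simp: dist_real_def)
    then show False using c by simp
  qed
  then show "a \<in> B" using b by simp
qed

lemma delone_dist_commute: "delone_dist A B = delone_dist B A"
proof -
  have "close_within A B = close_within B A" by (intro ext) (blast intro: close_within_sym)
  then show ?thesis by (simp add: delone_dist_def)
qed

lemma delone_dist_self: "delone_dist A A = 0"
proof -
  have "close_within A A \<epsilon>" if "\<epsilon> > 0" for \<epsilon>
    unfolding close_within_def using that by (intro exI[of _ 0]) auto
  then have "delone_dist A A \<le> \<epsilon>" if "0 < \<epsilon>" "\<epsilon> < 1" for \<epsilon> using that delone_dist_le by blast
  then have "delone_dist A A \<le> 0" using dense_ge_bounded[of 0 1 "delone_dist A A"] by simp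
  then show ?thesis using delone_dist_nonneg[of A A] by simp
qed

lemma delone_dist_triangle: "delone_dist A C \<le> delone_dist A B + delone_dist B C"
proof (rule ccontr)
  assume neg: "\<not> ?thesis"
  define g where "g = (delone_dist A C - delone_dist A B - delone_dist B C) / 2"
  have g: "g > 0" "delone_dist A C = delone_dist A B + delone_dist B C + 2 * g"
    using neg by (simp_all add: g_def field_simps)
  note bnd = delone_dist_le_1[of A C] delone_dist_nonneg[of A B] delone_dist_nonneg[of B C]
  obtain e where e: "0 < e" "e < delone_dist A B + g" "close_within A B e"
    using delone_dist_lessD[of A B "delone_dist A B + g"] g bnd by auto
  obtain f where f: "0 < f" "f < delone_dist B C + g" "close_within B C f"
    using delone_dist_lessD[of B C "delone_dist B C + g"] g bnd by auto
  have "e + f < 1" using e f g bnd by linarith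
  then have "delone_dist A C \<le> e + f"
    using close_within_triangle[OF e(3) f(3)] e f by (intro delone_dist_le) auto
  then show False using e f g by linarith
qed

lemma Metric_space_delone: "Metric_space (Collect delone) delone_dist"
proof
  show "(delone_dist A B = 0) = (A = B)" if "A \<in> Collect delone" "B \<in> Collect delone" for A B
  proof
    assume "delone_dist A B = 0"
    then show "A = B"
      using that delone_dist_zero_subset[of A B] delone_dist_zero_subset[of B A]
        delone_dist_commute[of A B] by simp
  qed (simp add: delone_dist_self)
qed (rule delone_dist_nonneg delone_dist_commute delone_dist_triangle)+

text \<open>
  By \<open>Metric_space_delone\<close>, the topology used here is the one induced by a metric.
\<close>

definition delone_hull :: "real set \<Rightarrow> real set set" where
  "delone_hull \<Lambda> = Metric_space.mtopology (Collect delone) delone_dist closure_of (range (translate \<Lambda>))"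

definition bd_equivalent :: "real set \<Rightarrow> real set \<Rightarrow> bool" where
  "bd_equivalent \<Lambda> \<Lambda>' \<longleftrightarrow>
     (\<exists>\<phi>. bij_betw \<phi> \<Lambda> \<Lambda>' \<and> (\<exists>C. \<forall>x\<in>\<Lambda>. \<bar>x - \<phi> x\<bar> \<le> C))"

definition bd_rel :: "real set set \<Rightarrow> (real set \<times> real set) set" where
  "bd_rel X = {(\<Lambda>, \<Lambda>'). \<Lambda> \<in> X \<and> \<Lambda>' \<in> X \<and> bd_equivalent \<Lambda> \<Lambda>'}"

lemma equiv_bd_rel: "equiv X (bd_rel X)"
proof (rule equivI)
  show "bd_rel X \<subseteq> X \<times> X" by (auto simp: bd_rel_def)
  have "bd_equivalent A A" for A
    unfolding bd_equivalent_def by (intro exI[of _ id]) auto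
  then show "refl_on X (bd_rel X)" by (auto simp: refl_on_def bd_rel_def)
  have "bd_equivalent B A" if AB: "bd_equivalent A B" for A B
  proof -
    obtain \<phi> C where \<phi>: "bij_betw \<phi> A B" "\<forall>x\<in>A. \<bar>x - \<phi> x\<bar> \<le> C"
      using AB unfolding bd_equivalent_def by blast
    have "\<bar>y - inv_into A \<phi> y\<bar> \<le> C" if y: "y \<in> B" for y
    proof -
      have "inv_into A \<phi> y \<in> A" "\<phi> (inv_into A \<phi> y) = y"
        using bij_betw_inv_into[OF \<phi>(1)] y bij_betw_inv_into_right[OF \<phi>(1)]
        by (auto simp: bij_betw_def)
      then show ?thesis using \<phi>(2) by (metis abs_minus_commute)
    qed
    then show ?thesis unfolding bd_equivalent_def using bij_betw_inv_into[OF \<phi>(1)] by blast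
  qed
  then show "sym (bd_rel X)" by (auto simp: sym_def bd_rel_def)
  have "bd_equivalent A D" if AB: "bd_equivalent A B" and BD: "bd_equivalent B D" for A B D
  proof -
    obtain \<phi> C where \<phi>: "bij_betw \<phi> A B" "\<forall>x\<in>A. \<bar>x - \<phi> x\<bar> \<le> C"
      using AB unfolding bd_equivalent_def by blast
    obtain \<psi> C' where \<psi>: "bij_betw \<psi> B D" "\<forall>x\<in>B. \<bar>x - \<psi> x\<bar> \<le> C'"
      using BD unfolding bd_equivalent_def by blast
    have "\<bar>x - (\<psi> \<circ> \<phi>) x\<bar> \<le> C + C'" if "x \<in> A" for x
    proof -
      have "\<bar>x - \<phi> x\<bar> \<le> C" "\<bar>\<phi> x - \<psi> (\<phi> x)\<bar> \<le> C'"
        using \<phi> \<psi> that by (auto simp: bij_betw_def)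
      then show ?thesis by simp
    qed
    then show ?thesis unfolding bd_equivalent_def using bij_betw_trans[OF \<phi>(1) \<psi>(1)] by blast
  qed
  then show "trans (bd_rel X)" unfolding trans_def bd_rel_def by blast
qed

definition tau :: real where
  "tau = (1 + sqrt 5) / 2"

definition Z_tau :: "real set" where
  "Z_tau = {of_int a + of_int b * tau | a b. True}"

text \<open>
  The algebraic conjugate, meaningful on \<open>Z_tau\<close> only; see \<open>conj_tau_eq\<close>.
\<close>

definition conj_tau :: "real \<Rightarrow> real" where
  "conj_tau x = (THE y. \<exists>a b. x = of_int a + of_int b * tau \<and> y = of_int a + of_int b * (1 - tau))"

lemma tau_irrational: "tau \<notin> \<rat>"
proof
  assume "tau \<in> \<rat>"
  then have "2 * tau - 1 \<in> \<rat>" by (intro Rats_diff Rats_mult) auto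
  moreover have "2 * tau - 1 = sqrt 5" by (simp add: tau_def field_simps)
  ultimately have "sqrt 5 \<in> \<rat>" by simp
  then obtain m n :: nat
    where n: "n \<noteq> 0" and sqrt: "\<bar>sqrt 5\<bar> = real m / real n" and cop: "coprime m n"
    by (rule Rats_abs_nat_div_natE)
  have "real m = sqrt 5 * real n" using n sqrt by simp
  then have "real (m\<^sup>2) = real (5 * n\<^sup>2)" by (simp add: power_mult_distrib)
  then have eq: "m\<^sup>2 = 5 * n\<^sup>2" using of_nat_eq_iff by blast
  have p: "prime (5 :: nat)" by simp
  have m: "5 dvd m" using eq p by (metis dvd_triv_left prime_dvd_power_nat)
  then obtain k where "m = 5 * k" ..
  with eq have "n\<^sup>2 = 5 * k\<^sup>2" by (simp add: power2_eq_square)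
  then have "5 dvd n" using p by (metis dvd_triv_left prime_dvd_power_nat)
  with m have "5 dvd gcd m n" by simp
  with cop show False by simp
qed

lemma conj_tau_eq: "conj_tau (of_int a + of_int b * tau) = of_int a + of_int b * (1 - tau)"
proof -
  have "a = c \<and> b = d"
    if eq: "of_int a + of_int b * tau = of_int c + of_int d * tau" for c d
  proof -
    have "b = d"
    proof (rule ccontr)
      assume "b \<noteq> d"
      then have "tau = of_int (c - a) / of_int (b - d)" using eq by (simp add: field_simps)
      then show False using tau_irrational by (metis Rats_divide Rats_of_int)
    qed
    then show ?thesis using eq by simp
  qed
  then show ?thesis unfolding conj_tau_def by (intro the_equality) blast+
qed

definition cut_and_project :: "real set \<Rightarrow> real set" where
  "cut_and_project W = {x \<in> Z_tau. conj_tau x \<in> W}"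

definition half_fibonacci :: "real set" where
  "half_fibonacci = cut_and_project {-1 ..< -1 + tau / 2}"

end

theory Submission
  imports Defs
begin

text \<open>
  Write \<open>x \<mapsto> x*\<close> for the conjugation on \<open>\<int>[\<tau>]\<close>. Every shifted half window gives a set
  \<open>\<Lambda>\<^sub>u = {x. u \<le> x* < u + \<tau> / 2}\<close> in the hull, because the numbers \<open>y*\<close> are dense
  and only finitely many points of \<open>\<int>[\<tau>]\<close> lie in a bounded region and have a bounded conjugate
  (\<open>half_window_set_in_hull\<close>). Bounded distance equivalent sets have counting functions on intervals
  \<open>[X, Y)\<close> that differ by a bounded amount (\<open>bd_equivalent_card_le\<close>), so it suffices to find
  uncountably many \<open>u\<close> with pairwise unbounded differences of these counts.

  Let \<open>\<lambda> = \<tau>\<^sup>1\<^sup>2\<close>, a unit with conjugate \<open>1 / \<lambda>\<close>. Moving the window from \<open>d\<close> to \<open>d + h\<close>,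
  with \<open>h\<close> the inverse of the \<open>m\<close>-th power of \<open>\<lambda>\<close>, adds the points with \<open>x*\<close> in
  \<open>[d + \<tau> / 2, d + \<tau> / 2 + h)\<close> and removes those with \<open>x*\<close> in \<open>[d, d + h)\<close>. Multiplication by
  \<open>h\<close>, whose conjugate is \<open>1 / h\<close>, reduces both strips to windows of length \<open>1\<close>, where each \<open>b\<close> gives exactly one point
  \<open>a + b\<tau> = x* + b \<surd>5\<close>. So each strip is a perturbed arithmetic progression with step
  \<open>\<surd>5 / h\<close>, the perturbation being less than \<open>1 / h\<close>. Since \<open>\<tau> / 2\<close> is half of an element
  of \<open>\<int>[\<tau>]\<close> and \<open>\<lambda> \<equiv> 1\<close> modulo \<open>2\<close>, the two progressions are offset by half a step up to a
  small error, and since \<open>\<surd>5 / 2 > 1\<close> they strictly interleave (\<open>interleaving_strips\<close>).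
  Choosing \<open>X\<close> and \<open>Y\<close> in suitable gaps between consecutive points, the change of the count
  on \<open>[X, Y)\<close> can be made \<open>1\<close> or \<open>-1\<close> at will (\<open>strip_count_jump\<close>).

  Now take for \<open>u\<close> the sum of the inverse powers of \<open>\<lambda>\<close> whose exponents are given by a set of
  naturals. Passing from one such point to another one digit at a time, each differing digit changes the
  count as above, at the scale of its own power of \<open>\<lambda>\<close>. Gaps at one scale are much longer than the
  period of the next smaller one, so \<open>X\<close> and \<open>Y\<close> can be chosen in the right gaps at all of the
  first \<open>J\<close> scales simultaneously (\<open>simultaneous_phases\<close>), and the changes add up to the number
  of differing digits; the remaining digits contribute at most \<open>1\<close>. Hence points whose digits
  differ infinitely often give inequivalent sets, and there are uncountably many digit sequences that
  pairwise differ infinitely often.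
\<close>

section \<open>Arithmetic of the golden ring\<close>

lemma sqrt5_eq: "sqrt 5 = 2 * tau - 1"
proof -
  have "2 * tau = 1 + sqrt 5" by (simp add: tau_def)
  then show ?thesis by simp
qed

lemma tau_sq: "tau * tau = tau + 1"
  by (simp add: tau_def field_simps)

lemma tau_bounds: "1618 / 1000 < tau" "tau < 1619 / 1000"
proof -
  have "2236 / 1000 < sqrt 5" by (rule real_less_rsqrt) (simp add: power2_eq_square)
  moreover have "sqrt 5 < 2238 / 1000" by (rule real_less_lsqrt) (simp_all add: power2_eq_square)
  ultimately show "1618 / 1000 < tau" "tau < 1619 / 1000" by (simp_all add: tau_def)
qed

lemma Z_tauI: "of_int a + of_int b * tau \<in> Z_tau"
  unfolding Z_tau_def by blast

lemma Z_tauE: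
  assumes "x \<in> Z_tau"
  obtains a b where "x = of_int a + of_int b * tau"
    "conj_tau x = of_int a + of_int b * (1 - tau)"
  using assms conj_tau_eq unfolding Z_tau_def by blast

lemma Z_tau_diff:
  assumes "x \<in> Z_tau" "y \<in> Z_tau"
  shows "x - y \<in> Z_tau" "conj_tau (x - y) = conj_tau x - conj_tau y"
proof -
  obtain a b where x: "x = of_int a + of_int b * tau"
    "conj_tau x = of_int a + of_int b * (1 - tau)" using assms(1) by (rule Z_tauE)
  obtain c d where y: "y = of_int c + of_int d * tau"
    "conj_tau y = of_int c + of_int d * (1 - tau)" using assms(2) by (rule Z_tauE)
  have e: "x - y = of_int (a - c) + of_int (b - d) * tau" by (simp add: x(1) y(1) algebra_simps)
  show "x - y \<in> Z_tau" unfolding e by (rule Z_tauI)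
  show "conj_tau (x - y) = conj_tau x - conj_tau y"
    unfolding e conj_tau_eq x(2) y(2) by (simp add: algebra_simps)
qed

lemma Z_tau_mult:
  assumes "x \<in> Z_tau" "y \<in> Z_tau"
  shows "x * y \<in> Z_tau" "conj_tau (x * y) = conj_tau x * conj_tau y"
proof -
  obtain a b where x: "x = of_int a + of_int b * tau"
    "conj_tau x = of_int a + of_int b * (1 - tau)" using assms(1) by (rule Z_tauE)
  obtain c d where y: "y = of_int c + of_int d * tau"
    "conj_tau y = of_int c + of_int d * (1 - tau)" using assms(2) by (rule Z_tauE)
  have "x * y = of_int a * of_int c + (of_int a * of_int d + of_int b * of_int c) * tau
      + of_int b * of_int d * (tau * tau)"
    by (simp add: x(1) y(1) algebra_simps)
  then have e: "x * y = of_int (a * c + b * d) + of_int (a * d + b * c + b * d) * tau"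
    unfolding tau_sq by (simp add: algebra_simps)
  show "x * y \<in> Z_tau" unfolding e by (rule Z_tauI)
  have "conj_tau x * conj_tau y = of_int a * of_int c
      + (of_int a * of_int d + of_int b * of_int c) * (1 - tau)
      + of_int b * of_int d * (1 - 2 * tau + tau * tau)"
    unfolding x(2) y(2) by (simp add: algebra_simps)
  then show "conj_tau (x * y) = conj_tau x * conj_tau y"
    unfolding e conj_tau_eq tau_sq by (simp add: algebra_simps)
qed

lemma Z_tau_add:
  assumes "x \<in> Z_tau" "y \<in> Z_tau"
  shows "x + y \<in> Z_tau" "conj_tau (x + y) = conj_tau x + conj_tau y"
proof -
  have z: "0 \<in> Z_tau" "conj_tau 0 = 0" using Z_tauI[of 0 0] conj_tau_eq[of 0 0] by simp_all
  have "x + y = x - (0 - y)" by simp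
  then show "x + y \<in> Z_tau" "conj_tau (x + y) = conj_tau x + conj_tau y"
    using Z_tau_diff[OF assms(1) Z_tau_diff(1)[OF z(1) assms(2)]]
      Z_tau_diff(2)[OF z(1) assms(2)] z(2) by simp_all
qed

text \<open>The product of \<open>x\<close> and its conjugate is the norm of \<open>x\<close>, a nonzero integer.\<close>

lemma Z_tau_norm_ge_1:
  assumes "x \<in> Z_tau" "x \<noteq> 0"
  shows "1 \<le> \<bar>x\<bar> * \<bar>conj_tau x\<bar>"
proof -
  obtain a b where x: "x = of_int a + of_int b * tau"
    "conj_tau x = of_int a + of_int b * (1 - tau)" using assms(1) by (rule Z_tauE)
  have "x * conj_tau x = of_int a * of_int a + of_int a * of_int b
      + of_int b * of_int b * (tau - tau * tau)"
    unfolding x(2) by (simp add: x(1) algebra_simps)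
  then have n: "x * conj_tau x = of_int (a * a + a * b - b * b)"
    unfolding tau_sq by (simp add: algebra_simps)
  have "conj_tau x \<noteq> 0"
  proof
    assume "conj_tau x = 0"
    then have c: "of_int b * tau = of_int (a + b)" using x(2) by (simp add: algebra_simps)
    have "b = 0"
    proof (rule ccontr)
      assume "b \<noteq> 0"
      then have "tau = of_int (a + b) / of_int b" using c by (simp add: field_simps)
      then show False using tau_irrational by (metis Rats_divide Rats_of_int)
    qed
    then show False using c x(1) assms(2) by simp
  qed
  then have "a * a + a * b - b * b \<noteq> 0" using n assms(2) by (metis mult_eq_0_iff of_int_0)
  then have "1 \<le> \<bar>a * a + a * b - b * b\<bar>" by linarith
  then have "1 \<le> \<bar>x * conj_tau x\<bar>" unfolding n by linarith
  then show ?thesis by (simp add: abs_mult)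
qed

lemma Z_tau_eqI:
  assumes "x \<in> Z_tau" "y \<in> Z_tau" "\<bar>x - y\<bar> * \<bar>conj_tau x - conj_tau y\<bar> < 1"
  shows "x = y"
  using Z_tau_norm_ge_1[of "x - y"] Z_tau_diff[OF assms(1,2)] assms(3) by force

text \<open>
  The pairs \<open>(x, x*)\<close> form a lattice in the plane: for \<open>x = a + b\<tau>\<close>, bounds on \<open>x\<close> and \<open>x*\<close>
  bound \<open>b \<surd>5 = x - x*\<close> and then \<open>a\<close>.
\<close>

lemma finite_Z_tau_box: "finite {x \<in> Z_tau. \<bar>x\<bar> \<le> R \<and> \<bar>conj_tau x\<bar> \<le> S}"
proof -
  define B where "B = \<lceil>\<bar>R\<bar> + \<bar>S\<bar>\<rceil>"
  have "{x \<in> Z_tau. \<bar>x\<bar> \<le> R \<and> \<bar>conj_tau x\<bar> \<le> S} \<subseteq>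
      (\<lambda>(a, b). of_int a + of_int b * tau) ` ({- 3 * B..3 * B} \<times> {- B..B})"
  proof safe
    fix x assume x: "x \<in> Z_tau" "\<bar>x\<bar> \<le> R" "\<bar>conj_tau x\<bar> \<le> S"
    obtain a b where ab: "x = of_int a + of_int b * tau"
      "conj_tau x = of_int a + of_int b * (1 - tau)" using x(1) by (rule Z_tauE)
    have RB: "\<bar>R\<bar> + \<bar>S\<bar> \<le> of_int B" by (simp add: B_def)
    have "of_int b * sqrt 5 = x - conj_tau x" unfolding ab(2) by (simp add: ab(1) sqrt5_eq algebra_simps)
    then have "\<bar>of_int b\<bar> * sqrt 5 \<le> of_int B" using x RB by (simp add: abs_mult flip: abs_mult)
    moreover have "\<bar>of_int b :: real\<bar> * 1 \<le> \<bar>of_int b\<bar> * sqrt 5" by (intro mult_left_mono) auto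
    ultimately have b1: "\<bar>of_int b :: real\<bar> \<le> of_int B" by linarith
    then have b: "\<bar>b\<bar> \<le> B" by linarith
    have "\<bar>of_int b * tau\<bar> \<le> of_int B * 2"
      unfolding abs_mult using b1 tau_bounds by (intro mult_mono) auto
    then have "\<bar>of_int a :: real\<bar> \<le> of_int (3 * B)" using ab(1) x(2) RB by simp
    then have "\<bar>a\<bar> \<le> 3 * B" by linarith
    then show "x \<in> (\<lambda>(a, b). of_int a + of_int b * tau) ` ({- 3 * B..3 * B} \<times> {- B..B})"
      using b ab(1) by (intro image_eqI[of _ _ "(a, b)"]) auto
  qed
  then show ?thesis by (rule finite_subset) auto
qed

section \<open>Points with conjugate in a short interval\<close>

text \<open>
  Three properties dictate the exponent. It is even, so that the conjugate of \<open>scale\<close> is its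
  inverse and not minus its inverse. It is divisible by \<open>3\<close>, the order of \<open>\<tau>\<close> modulo \<open>2\<close>,
  so that \<open>scale \<equiv> 1\<close> modulo \<open>2\<close>. It makes \<open>scale\<close> exceed \<open>100\<close>, which separates the
  scales in \<open>simultaneous_phases\<close>; the sixth power of \<open>\<tau>\<close> is only about \<open>18\<close>.
\<close>

definition scale :: real where
  "scale = tau ^ 12"

lemma scale_eq: "scale = 144 * tau + 89"
proof -
  have 3: "tau ^ 3 = 2 * tau + 1"
    using tau_sq by (simp add: power3_eq_cube algebra_simps)
  have 6: "tau ^ 6 = 8 * tau + 5"
  proof -
    have "tau ^ 6 = tau ^ 3 * tau ^ 3" by (simp flip: power_add)
    then show ?thesis unfolding 3 using tau_sq by (simp add: algebra_simps)
  qed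
  have "scale = tau ^ 6 * tau ^ 6" by (simp add: scale_def flip: power_add)
  then show ?thesis unfolding 6 using tau_sq by (simp add: algebra_simps)
qed

lemma scale_gt: "300 < scale"
  using tau_bounds by (simp add: scale_eq)

lemma scale_pos [simp]: "0 < scale" "scale \<noteq> 0"
  using scale_gt by auto

text \<open>
  The parities of the coefficients say that the powers of \<open>scale\<close> are congruent to \<open>1\<close> modulo \<open>2\<close>,
  so multiplication by them preserves the class of \<open>\<tau> / 2\<close> modulo \<open>\<int>[\<tau>]\<close>.
\<close>

lemma scale_pow_Z_tau:
  "scale ^ m \<in> Z_tau" "conj_tau (scale ^ m) = 1 / scale ^ m"
  "1 / scale ^ m \<in> Z_tau" "conj_tau (1 / scale ^ m) = scale ^ m"
  "\<exists>a b. odd a \<and> even b \<and> scale ^ m = of_int a + of_int b * tau"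
proof -
  have "scale * (233 - 144 * tau) = 1"
    unfolding scale_eq using tau_sq by (simp add: algebra_simps)
  then have inv: "1 / scale = 233 - 144 * tau" using scale_gt by (simp add: field_simps)
  have s: "scale \<in> Z_tau" "conj_tau scale = 1 / scale"
    "1 / scale \<in> Z_tau" "conj_tau (1 / scale) = scale"
    using Z_tauI[of 89 144] conj_tau_eq[of 89 144] Z_tauI[of 233 "-144"] conj_tau_eq[of 233 "-144"]
    unfolding inv by (simp_all add: scale_eq algebra_simps)
  have o: "1 \<in> Z_tau" "conj_tau 1 = 1" using Z_tauI[of 1 0] conj_tau_eq[of 1 0] by simp_all
  have *: "scale ^ m \<in> Z_tau \<and> conj_tau (scale ^ m) = (1 / scale) ^ m
    \<and> (1 / scale) ^ m \<in> Z_tau \<and> conj_tau ((1 / scale) ^ m) = scale ^ m"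
  proof (induction m)
    case (Suc m)
    then show ?case
      using Z_tau_mult[of scale "scale ^ m"] Z_tau_mult[of "1 / scale" "(1 / scale) ^ m"] s by simp
  qed (simp add: o)
  then show "scale ^ m \<in> Z_tau" "conj_tau (scale ^ m) = 1 / scale ^ m"
    "1 / scale ^ m \<in> Z_tau" "conj_tau (1 / scale ^ m) = scale ^ m"
    by (simp_all add: power_divide)
  show "\<exists>a b. odd a \<and> even b \<and> scale ^ m = of_int a + of_int b * tau"
  proof (induction m)
    case 0
    show ?case by (intro exI[of _ 1] exI[of _ 0]) simp
  next
    case (Suc m)
    then obtain a b where ab: "odd a" "even b" "scale ^ m = of_int a + of_int b * tau" by blast
    have "scale ^ Suc m = scale * (of_int a + of_int b * tau)" using ab(3) by simp
    also have "\<dots> = 89 * of_int a + (144 * of_int a + 89 * of_int b) * tau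
        + 144 * of_int b * (tau * tau)"
      unfolding scale_eq by (simp add: algebra_simps)
    finally have "scale ^ Suc m = of_int (89 * a + 144 * b) + of_int (144 * a + 233 * b) * tau"
      unfolding tau_sq by (simp add: algebra_simps)
    then show ?case using ab(1,2)
      by (intro exI[of _ "89 * a + 144 * b"] exI[of _ "144 * a + 233 * b"]) simp
  qed
qed

text \<open>
  Division by a power of \<open>scale\<close> turns the strip into one of height \<open>1\<close>. There every integer \<open>b\<close>
  admits exactly one \<open>a\<close> with \<open>a + b\<tau>\<close> in the strip, and \<open>a + b\<tau>\<close> exceeds its conjugate
  by \<open>b \<surd>5\<close>.
\<close>

lemma strip_enumeration:
  obtains p :: "int \<Rightarrow> real"
  where "{x \<in> Z_tau. d \<le> conj_tau x \<and> conj_tau x < d + 1 / scale ^ m} = range p"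
    "\<And>b. scale ^ m * (of_int b * sqrt 5 + scale ^ m * d) \<le> p b"
    "\<And>b. p b < scale ^ m * (of_int b * sqrt 5 + scale ^ m * d + 1)"
proof -
  define e where "e = scale ^ m * d"
  define a where "a b = \<lceil>e - of_int b * (1 - tau)\<rceil>" for b :: int
  define w where "w b = of_int (a b) + of_int b * tau" for b :: int
  have pos: "0 < scale ^ m" using scale_gt by simp
  have w: "w b \<in> Z_tau" "conj_tau (w b) = of_int (a b) + of_int b * (1 - tau)"
    "w b = conj_tau (w b) + of_int b * sqrt 5" for b
    unfolding w_def conj_tau_eq by (rule Z_tauI, simp_all add: sqrt5_eq algebra_simps)
  have cw: "e \<le> conj_tau (w b)" "conj_tau (w b) < e + 1" for b
    unfolding w(2) a_def by linarith+
  have conv: "d \<le> c \<and> c < d + 1 / scale ^ m \<longleftrightarrow> e \<le> scale ^ m * c \<and> scale ^ m * c < e + 1" for c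
  proof -
    have "d \<le> c \<and> c < d + 1 / S \<longleftrightarrow> S * d \<le> S * c \<and> S * c < S * d + 1" if "0 < S" for S
      using that by (simp add: field_simps)
    from this[OF pos] show ?thesis by (simp add: e_def)
  qed
  show ?thesis
  proof (rule that[of "\<lambda>b. scale ^ m * w b"])
    show "{x \<in> Z_tau. d \<le> conj_tau x \<and> conj_tau x < d + 1 / scale ^ m}
        = range (\<lambda>b. scale ^ m * w b)" (is "?L = ?R")
    proof (intro subset_antisym subsetI)
      fix x assume "x \<in> ?L"
      then have x: "x \<in> Z_tau" "e \<le> scale ^ m * conj_tau x" "scale ^ m * conj_tau x < e + 1"
        using conv by auto
      have "1 / scale ^ m * x \<in> Z_tau" by (intro Z_tau_mult scale_pow_Z_tau x)
      then obtain k b where kb: "1 / scale ^ m * x = of_int k + of_int b * tau"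
        "conj_tau (1 / scale ^ m * x) = of_int k + of_int b * (1 - tau)" by (rule Z_tauE)
      have "conj_tau (1 / scale ^ m * x) = scale ^ m * conj_tau x"
        using Z_tau_mult(2)[OF scale_pow_Z_tau(3) x(1)] scale_pow_Z_tau(4) by simp
      then have "k = a b" using kb(2) x(2,3) unfolding a_def by linarith
      then have "1 / scale ^ m * x = w b" unfolding kb(1) w_def by simp
      moreover have "x = scale ^ m * (1 / scale ^ m * x)" using scale_gt by auto
      ultimately have "x = scale ^ m * w b" by metis
      then show "x \<in> ?R" by blast
    next
      fix x assume "x \<in> ?R"
      then obtain b where b: "x = scale ^ m * w b" by blast
      have "conj_tau x = conj_tau (w b) / scale ^ m"
        unfolding b using Z_tau_mult(2)[OF scale_pow_Z_tau(1) w(1)] scale_pow_Z_tau(2) by simp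
      then have "scale ^ m * conj_tau x = conj_tau (w b)" using pos by simp
      then show "x \<in> ?L" using cw[of b] conv Z_tau_mult(1)[OF scale_pow_Z_tau(1) w(1)] b by simp
    qed
    show "scale ^ m * (of_int b * sqrt 5 + scale ^ m * d) \<le> scale ^ m * w b"
      "scale ^ m * w b < scale ^ m * (of_int b * sqrt 5 + scale ^ m * d + 1)" for b
      using cw[of b] pos by (subst w(3), simp add: e_def)+
  qed
qed

section \<open>Counting points in windows\<close>

definition strip_count :: "real \<Rightarrow> real \<Rightarrow> real \<Rightarrow> real \<Rightarrow> nat" where
  "strip_count X Y u v = card {x \<in> Z_tau. X \<le> x \<and> x < Y \<and> u \<le> conj_tau x \<and> conj_tau x < v}"

lemma finite_strip: "finite {x \<in> Z_tau. X \<le> x \<and> x < Y \<and> u \<le> conj_tau x \<and> conj_tau x < v}"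
proof (rule finite_subset[OF _ finite_Z_tau_box])
  show "{x \<in> Z_tau. X \<le> x \<and> x < Y \<and> u \<le> conj_tau x \<and> conj_tau x < v}
      \<subseteq> {x \<in> Z_tau. \<bar>x\<bar> \<le> \<bar>X\<bar> + \<bar>Y\<bar> \<and> \<bar>conj_tau x\<bar> \<le> \<bar>u\<bar> + \<bar>v\<bar>}"
  proof safe
    fix x assume "X \<le> x" "x < Y" "u \<le> conj_tau x" "conj_tau x < v"
    then show "\<bar>x\<bar> \<le> \<bar>X\<bar> + \<bar>Y\<bar>" "\<bar>conj_tau x\<bar> \<le> \<bar>u\<bar> + \<bar>v\<bar>" by linarith+
  qed
qed

lemma strip_count_split:
  assumes "u \<le> v" "v \<le> w"
  shows "strip_count X Y u w = strip_count X Y u v + strip_count X Y v w"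
proof -
  have "{x \<in> Z_tau. X \<le> x \<and> x < Y \<and> u \<le> conj_tau x \<and> conj_tau x < w} =
      {x \<in> Z_tau. X \<le> x \<and> x < Y \<and> u \<le> conj_tau x \<and> conj_tau x < v} \<union>
      {x \<in> Z_tau. X \<le> x \<and> x < Y \<and> v \<le> conj_tau x \<and> conj_tau x < w}"
    using assms by auto
  moreover have "{x \<in> Z_tau. X \<le> x \<and> x < Y \<and> u \<le> conj_tau x \<and> conj_tau x < v} \<inter>
      {x \<in> Z_tau. X \<le> x \<and> x < Y \<and> v \<le> conj_tau x \<and> conj_tau x < w} = {}"
    by auto
  ultimately show ?thesis
    unfolding strip_count_def by (simp only: card_Un_disjoint[OF finite_strip finite_strip])
qed

text \<open>Two points of the box would have a difference of norm less than \<open>1\<close>.\<close>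

lemma strip_count_le_1:
  assumes "(Y - X) * h < 1"
  shows "strip_count X Y u (u + h) \<le> 1"
proof -
  have "x = y" if x: "x \<in> Z_tau" "X \<le> x" "x < Y" "u \<le> conj_tau x" "conj_tau x < u + h"
    and y: "y \<in> Z_tau" "X \<le> y" "y < Y" "u \<le> conj_tau y" "conj_tau y < u + h" for x y
  proof -
    have "\<bar>x - y\<bar> * \<bar>conj_tau x - conj_tau y\<bar> \<le> (Y - X) * h"
      using x y by (intro mult_mono) linarith+
    then show ?thesis using assms by (intro Z_tau_eqI x(1) y(1)) linarith
  qed
  then show ?thesis
    unfolding strip_count_def One_nat_def by (subst card_le_Suc0_iff_eq[OF finite_strip]) blast
qed

definition window_count :: "real \<Rightarrow> real \<Rightarrow> real \<Rightarrow> nat" where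
  "window_count X Y u = strip_count X Y u (u + tau / 2)"

text \<open>Shifting the window gains a strip at its upper end and loses one at its lower end.\<close>

lemma window_count_shift:
  assumes "0 \<le> h" "h \<le> tau / 2"
  shows "real (window_count X Y (u + h)) - real (window_count X Y u) =
    real (strip_count X Y (u + tau / 2) (u + tau / 2 + h)) - real (strip_count X Y u (u + h))"
proof -
  have "strip_count X Y u (u + h) + window_count X Y (u + h)
      = strip_count X Y u (u + h + tau / 2)"
    unfolding window_count_def using assms tau_bounds by (subst strip_count_split) auto
  also have "\<dots> = window_count X Y u + strip_count X Y (u + tau / 2) (u + tau / 2 + h)"
    unfolding window_count_def using assms tau_bounds
    by (subst strip_count_split[of _ "u + tau / 2"]) (auto simp: add_ac)
  finally show ?thesis by linarith
qed

lemma window_count_near: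
  assumes "\<bar>u - v\<bar> \<le> tau / 2" "(Y - X) * \<bar>u - v\<bar> < 1"
  shows "\<bar>real (window_count X Y u) - real (window_count X Y v)\<bar> \<le> 1"
proof -
  have *: "\<bar>real (window_count X Y (w + h)) - real (window_count X Y w)\<bar> \<le> 1"
    if "0 \<le> h" "h \<le> tau / 2" "(Y - X) * h < 1" for w h
    using window_count_shift[OF that(1,2), of X Y w] strip_count_le_1[OF that(3), of w]
      strip_count_le_1[OF that(3), of "w + tau / 2"] by linarith
  show ?thesis
  proof (cases "u \<le> v")
    case True
    then show ?thesis using *[of "v - u" u] assms by (simp add: abs_minus_commute)
  next
    case False
    then show ?thesis using *[of "u - v" v] assms by simp
  qed
qed

section \<open>Interleaving of the gained and the lost strip\<close>

lemma int_step_strict_mono: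
  fixes p :: "int \<Rightarrow> real"
  assumes step: "\<And>n. p n < p (n + 1)" and "m < n"
  shows "p m < p n"
  using \<open>m < n\<close>
proof (induction n rule: int_gr_induct)
  case (step n)
  then show ?case using assms(1)[of n] by linarith
qed (rule assms(1))

lemma card_range_Int_interval:
  fixes p :: "int \<Rightarrow> real"
  assumes step: "\<And>n. p n < p (n + 1)"
    and X: "p b < X" "X \<le> p (b + 1)" and Y: "p c < Y" "Y \<le> p (c + 1)" and "X \<le> Y"
  shows "real (card {x \<in> range p. X \<le> x \<and> x < Y}) = of_int (c - b)"
proof -
  note mono = int_step_strict_mono[of p, OF step]
  have le: "p m \<le> p n" if "m \<le> n" for m n
    using mono[of m n] that by (cases "m = n") auto
  have "X \<le> p n \<longleftrightarrow> b < n" for n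
    using le[of n b] le[of "b + 1" n] X by (cases "b < n") auto
  moreover have "p n < Y \<longleftrightarrow> n \<le> c" for n
    using le[of n c] le[of "c + 1" n] Y by (cases "n \<le> c") auto
  ultimately have "{x \<in> range p. X \<le> x \<and> x < Y} = p ` {b<..c}" by auto
  moreover have "inj p"
    by (rule injI) (metis mono less_irrefl linorder_neqE)
  ultimately have "card {x \<in> range p. X \<le> x \<and> x < Y} = nat (c - b)"
    by (simp add: card_image inj_on_subset[of p UNIV])
  moreover have "b \<le> c" using le[of "c + 1" b] X Y \<open>X \<le> Y\<close> by (cases "b \<le> c") auto
  ultimately show ?thesis by simp
qed

text \<open>
  The parameter \<open>t\<close> is a position within one step of the progression that enumerates the strip above
  \<open>d\<close>, measured in multiples of the \<open>m\<close>-th power of \<open>scale\<close>. Only \<open>t = 1\<close> and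
  \<open>t = 2.12\<close> occur below: these phases lie after a lost and before the next gained point, and after
  a gained and before the next lost point, respectively.
\<close>

definition in_phase :: "real \<Rightarrow> real \<Rightarrow> nat \<Rightarrow> real \<Rightarrow> bool" where
  "in_phase t d m X \<longleftrightarrow> (\<exists>b::int.
     X \<in> {scale ^ m * (of_int b * sqrt 5 + scale ^ m * d + t)..
          scale ^ m * (of_int b * sqrt 5 + scale ^ m * d + t + 1 / 10)})"

text \<open>
  In units of the \<open>m\<close>-th power of \<open>scale\<close>, the lost points \<open>p b\<close> are spread over
  \<open>b \<surd>5 + [0, 1)\<close> up to a common shift. The gained points are enumerated in the same way with
  \<open>d + \<tau> / 2\<close> for \<open>d\<close>, and \<open>\<tau> / 2\<close> scaled up is an odd multiple of \<open>\<surd>5 / 2\<close>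
  up to a tiny error, so after an index shift they are spread over \<open>(b + 1 / 2) \<surd>5 + [0, 1)\<close>. As
  \<open>\<surd>5 / 2 = 1.118\<dots>\<close>, gaps of length at least \<open>1 / 10\<close> remain between the two kinds.
\<close>

lemma interleaving_strips:
  assumes "0 < m"
  obtains p q :: "int \<Rightarrow> real"
  where "{x \<in> Z_tau. d \<le> conj_tau x \<and> conj_tau x < d + 1 / scale ^ m} = range p"
    "{x \<in> Z_tau. d + tau / 2 \<le> conj_tau x \<and> conj_tau x < d + tau / 2 + 1 / scale ^ m} = range q"
    "\<And>b. p b < scale ^ m * (of_int b * sqrt 5 + scale ^ m * d + 1)"
    "\<And>b. scale ^ m * (of_int b * sqrt 5 + scale ^ m * d + 11 / 10) < q b"
    "\<And>b. q b < scale ^ m * (of_int b * sqrt 5 + scale ^ m * d + 212 / 100)"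
    "\<And>b. scale ^ m * (of_int b * sqrt 5 + scale ^ m * d + 222 / 100) < p (b + 1)"
proof -
  define S where "S = scale ^ m"
  have "scale ^ 1 \<le> scale ^ m" using assms scale_gt by (intro power_increasing) auto
  then have S: "300 < S" using scale_gt by (simp add: S_def)
  obtain p where p: "{x \<in> Z_tau. d \<le> conj_tau x \<and> conj_tau x < d + 1 / S} = range p"
    "\<And>b. S * (of_int b * sqrt 5 + S * d) \<le> p b"
    "\<And>b. p b < S * (of_int b * sqrt 5 + S * d + 1)"
    using strip_enumeration[of d m] unfolding S_def by blast
  obtain r where r: "{x \<in> Z_tau. d + tau / 2 \<le> conj_tau x \<and> conj_tau x < d + tau / 2 + 1 / S} = range r"
    "\<And>b. S * (of_int b * sqrt 5 + S * (d + tau / 2)) \<le> r b"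
    "\<And>b. r b < S * (of_int b * sqrt 5 + S * (d + tau / 2) + 1)"
    using strip_enumeration[of "d + tau / 2" m] unfolding S_def by blast
  obtain a b where ab: "odd a" "even b" "S = of_int a + of_int b * tau"
    using scale_pow_Z_tau(5)[of m] unfolding S_def by blast
  obtain c where c: "a + b = 2 * c + 1" using ab(1,2) by (metis odd_add oddE)
  have "conj_tau S = of_int a + of_int b * (1 - tau)" unfolding ab(3) by (rule conj_tau_eq)
  then have inv: "1 / S = of_int a + of_int b * (1 - tau)"
    using scale_pow_Z_tau(2)[of m] by (simp add: S_def)
  define z where "z = (tau - 1) / (2 * S)"
  \<comment> \<open>The element \<open>S * tau\<close> of the ring has odd coefficient \<open>a + b\<close> at \<open>tau\<close>; it is its conjugate
    \<open>- 2 * z\<close> plus that odd coefficient times \<open>sqrt 5\<close>.\<close>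
  have shift: "S * (tau / 2) = of_int c * sqrt 5 + sqrt 5 / 2 - z"
  proof -
    have t: "tau * tau = tau + 1" by (rule tau_sq)
    have "2 * (of_int c * sqrt 5 + sqrt 5 / 2) = of_int (2 * c + 1) * sqrt 5"
      by (simp add: algebra_simps)
    also have "\<dots> = of_int (a + b) * (2 * tau - 1)" by (simp only: c sqrt5_eq)
    finally have 1: "2 * (of_int c * sqrt 5 + sqrt 5 / 2) = of_int (a + b) * (2 * tau - 1)" .
    have "(tau - 1) / S = (tau - 1) * (1 / S)" by simp
    also have "\<dots> = of_int a * (tau - 1) + of_int b * (2 * tau - 1 - tau * tau)"
      unfolding inv by (simp add: algebra_simps)
    finally have 2: "(tau - 1) / S = of_int a * (tau - 1) + of_int b * (tau - 2)"
      unfolding t by (simp add: algebra_simps)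
    have "S * tau = of_int a * tau + of_int b * (tau * tau)"
      unfolding ab(3) by (simp add: algebra_simps)
    then have "S * tau = 2 * (of_int c * sqrt 5 + sqrt 5 / 2) - (tau - 1) / S"
      unfolding 1 2 t by (simp add: algebra_simps)
    moreover have "(tau - 1) / S = 2 * z" using S by (simp add: z_def field_simps)
    moreover have "2 * (S * (tau / 2)) = S * tau" by simp
    moreover have "x = k - y" if "w = 2 * k - z" "z = 2 * y" "2 * x = w" for x y z w k :: real
      using that by linarith
    ultimately show ?thesis by blast
  qed
  have small: "0 < z" "z < 1 / 100"
    using S tau_bounds by (simp_all add: z_def field_simps)
  have e: "of_int (b - c) * sqrt 5 + S * (d + tau / 2)
      = of_int b * sqrt 5 + S * d + (sqrt 5 / 2 - z)" for b
    using shift by (simp add: algebra_simps)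
  have root: "2236 / 1000 < sqrt 5" "sqrt 5 < 2238 / 1000"
    unfolding sqrt5_eq using tau_bounds by auto
  show ?thesis
  proof (rule that[of p "\<lambda>b. r (b - c)"])
    show "{x \<in> Z_tau. d + tau / 2 \<le> conj_tau x \<and> conj_tau x < d + tau / 2 + 1 / scale ^ m}
        = range (\<lambda>b. r (b - c))"
    proof -
      have "surj (\<lambda>b. b - c)" by (rule surjI[of _ "\<lambda>b. b + c"]) simp
      then have "range (\<lambda>b. r (b - c)) = range r" by (metis image_image)
      then show ?thesis using r(1) by (simp add: S_def)
    qed
    fix b
    have "S * (of_int b * sqrt 5 + S * d + 11 / 10) < S * (of_int (b - c) * sqrt 5 + S * (d + tau / 2))"
      unfolding e using S small root by simp
    also have "\<dots> \<le> r (b - c)" by (rule r)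
    finally show "scale ^ m * (of_int b * sqrt 5 + scale ^ m * d + 11 / 10) < r (b - c)"
      by (simp add: S_def)
    have "r (b - c) < S * (of_int (b - c) * sqrt 5 + S * (d + tau / 2) + 1)" by (rule r)
    also have "\<dots> < S * (of_int b * sqrt 5 + S * d + 212 / 100)"
      unfolding e using S small root by simp
    finally show "r (b - c) < scale ^ m * (of_int b * sqrt 5 + scale ^ m * d + 212 / 100)"
      by (simp add: S_def)
    have "S * (of_int b * sqrt 5 + S * d + 222 / 100) < S * (of_int (b + 1) * sqrt 5 + S * d)"
      using S root by (simp add: algebra_simps)
    also have "\<dots> \<le> p (b + 1)" by (rule p)
    finally show "scale ^ m * (of_int b * sqrt 5 + scale ^ m * d + 222 / 100) < p (b + 1)"
      by (simp add: S_def)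
  qed (use p in \<open>simp_all add: S_def\<close>)
qed

text \<open>
  Lost and gained points alternate. An interval from just before a gained point to just before a lost
  point therefore contains one more gained than lost point, and dually.
\<close>

lemma strip_count_jump:
  assumes "0 < m" "X \<le> Y"
  shows "in_phase 1 d m X \<Longrightarrow> in_phase (212 / 100) d m Y \<Longrightarrow>
      real (strip_count X Y (d + tau / 2) (d + tau / 2 + 1 / scale ^ m))
        - real (strip_count X Y d (d + 1 / scale ^ m)) = 1"
    "in_phase (212 / 100) d m X \<Longrightarrow> in_phase 1 d m Y \<Longrightarrow>
      real (strip_count X Y (d + tau / 2) (d + tau / 2 + 1 / scale ^ m))
        - real (strip_count X Y d (d + 1 / scale ^ m)) = - 1"
proof -
  obtain p q where pq:
    "{x \<in> Z_tau. d \<le> conj_tau x \<and> conj_tau x < d + 1 / scale ^ m} = range p"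
    "{x \<in> Z_tau. d + tau / 2 \<le> conj_tau x \<and> conj_tau x < d + tau / 2 + 1 / scale ^ m} = range q"
    "\<And>b. p b < scale ^ m * (of_int b * sqrt 5 + scale ^ m * d + 1)"
    "\<And>b. scale ^ m * (of_int b * sqrt 5 + scale ^ m * d + 11 / 10) < q b"
    "\<And>b. q b < scale ^ m * (of_int b * sqrt 5 + scale ^ m * d + 212 / 100)"
    "\<And>b. scale ^ m * (of_int b * sqrt 5 + scale ^ m * d + 222 / 100) < p (b + 1)"
    by (rule interleaving_strips[OF assms(1), of d]) (rule that)
  have pos: "0 < scale ^ m" using scale_gt by simp
  have o1: "p b < q b" for b
  proof -
    have "p b < scale ^ m * (of_int b * sqrt 5 + scale ^ m * d + 1)" by (rule pq)
    also have "\<dots> \<le> scale ^ m * (of_int b * sqrt 5 + scale ^ m * d + 11 / 10)" using pos by simp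
    also have "\<dots> < q b" by (rule pq)
    finally show ?thesis .
  qed
  have o2: "q b < p (b + 1)" for b
  proof -
    have "q b < scale ^ m * (of_int b * sqrt 5 + scale ^ m * d + 212 / 100)" by (rule pq)
    also have "\<dots> \<le> scale ^ m * (of_int b * sqrt 5 + scale ^ m * d + 222 / 100)" using pos by simp
    also have "\<dots> < p (b + 1)" by (rule pq)
    finally show ?thesis .
  qed
  have ord: "p b < q b" "q b < p (b + 1)" "p b < p (b + 1)" "q b < q (b + 1)" "q (b - 1) < p b" for b
    using o1[of b] o2[of b] o1[of "b + 1"] o2[of "b - 1"] by simp_all
  have "{x \<in> Z_tau. X \<le> x \<and> x < Y \<and> d \<le> conj_tau x \<and> conj_tau x < d + 1 / scale ^ m}
      = {x \<in> range p. X \<le> x \<and> x < Y}"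
    "{x \<in> Z_tau. X \<le> x \<and> x < Y \<and> d + tau / 2 \<le> conj_tau x \<and> conj_tau x < d + tau / 2 + 1 / scale ^ m}
      = {x \<in> range q. X \<le> x \<and> x < Y}"
    unfolding pq(1,2)[symmetric] by blast+
  then have cnt: "strip_count X Y d (d + 1 / scale ^ m) = card {x \<in> range p. X \<le> x \<and> x < Y}"
    "strip_count X Y (d + tau / 2) (d + tau / 2 + 1 / scale ^ m) = card {x \<in> range q. X \<le> x \<and> x < Y}"
    unfolding strip_count_def by (simp_all only:)
  have early: "\<exists>b. p b < Z \<and> Z < q b" if Z: "in_phase 1 d m Z" for Z
  proof -
    obtain b :: int where b: "scale ^ m * (of_int b * sqrt 5 + scale ^ m * d + 1) \<le> Z"
      "Z \<le> scale ^ m * (of_int b * sqrt 5 + scale ^ m * d + 1 + 1 / 10)"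
      using Z unfolding in_phase_def atLeastAtMost_iff by blast
    have "p b < Z" using less_le_trans[OF pq(3) b(1)] .
    moreover have "Z < q b" using b(2) pq(4)[of b] by (simp add: add.assoc)
    ultimately show ?thesis by blast
  qed
  have late: "\<exists>b. q b < Z \<and> Z < p (b + 1)" if Z: "in_phase (212 / 100) d m Z" for Z
  proof -
    obtain b :: int where b: "scale ^ m * (of_int b * sqrt 5 + scale ^ m * d + 212 / 100) \<le> Z"
      "Z \<le> scale ^ m * (of_int b * sqrt 5 + scale ^ m * d + 212 / 100 + 1 / 10)"
      using Z unfolding in_phase_def atLeastAtMost_iff by blast
    have "q b < Z" using less_le_trans[OF pq(5) b(1)] .
    moreover have "Z < p (b + 1)" using b(2) pq(6)[of b] by (simp add: add.assoc)
    ultimately show ?thesis by blast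
  qed
  show "real (strip_count X Y (d + tau / 2) (d + tau / 2 + 1 / scale ^ m))
        - real (strip_count X Y d (d + 1 / scale ^ m)) = 1"
    if X: "in_phase 1 d m X" and Y: "in_phase (212 / 100) d m Y"
  proof -
    obtain b where b: "p b < X" "X < q b" using early X by blast
    obtain c where c: "q c < Y" "Y < p (c + 1)" using late Y by blast
    have "real (card {x \<in> range p. X \<le> x \<and> x < Y}) = of_int (c - b)"
      using b c ord[of b] ord[of c] assms(2)
      by (intro card_range_Int_interval ord) linarith+
    moreover have "real (card {x \<in> range q. X \<le> x \<and> x < Y}) = of_int (c - (b - 1))"
      using b c ord[of b] ord[of "c + 1"] assms(2)
      by (intro card_range_Int_interval ord) simp_all
    ultimately show ?thesis unfolding cnt by simp
  qed
  show "real (strip_count X Y (d + tau / 2) (d + tau / 2 + 1 / scale ^ m))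
        - real (strip_count X Y d (d + 1 / scale ^ m)) = - 1"
    if X: "in_phase (212 / 100) d m X" and Y: "in_phase 1 d m Y"
  proof -
    obtain b where b: "q b < X" "X < p (b + 1)" using late X by blast
    obtain c where c: "p c < Y" "Y < q c" using early Y by blast
    have "real (card {x \<in> range p. X \<le> x \<and> x < Y}) = of_int (c - b)"
      using b c ord[of b] ord[of c] assms(2)
      by (intro card_range_Int_interval ord) linarith+
    moreover have "real (card {x \<in> range q. X \<le> x \<and> x < Y}) = of_int (c - 1 - b)"
      using b c ord[of "b + 1"] ord[of c] assms(2)
      by (intro card_range_Int_interval ord) simp_all
    ultimately show ?thesis unfolding cnt by simp
  qed
qed

section \<open>Changing many digits at once\<close>

text \<open>
  The phases are prescribed from the largest scale downwards. An interval of ten units of the scale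
  \<open>J\<close> contains a full period, hence a phase interval, of length a tenth of a unit; this is at least ten
  units of the scale \<open>J - 1\<close>, so the next phase can be met inside it.
\<close>

lemma simultaneous_phases:
  "\<exists>X. x \<le> X \<and> X \<le> x + 10 * scale ^ J \<and> (\<forall>j<J. in_phase (t j) (d j) (Suc j) X)"
proof (induction J arbitrary: x)
  case 0
  show ?case using scale_gt by (intro exI[of _ x]) simp
next
  case (Suc J)
  define S where "S = scale ^ Suc J"
  have S: "100 * scale ^ J \<le> S" "0 < S" using scale_gt by (simp_all add: S_def)
  define e where "e = S * d J + t J"
  define b where "b = \<lceil>(x / S - e) / sqrt 5\<rceil>"
  define x' where "x' = S * (of_int b * sqrt 5 + e)"
  have root: "0 < sqrt 5" "sqrt 5 < 3" unfolding sqrt5_eq using tau_bounds by auto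
  have "x / S \<le> of_int b * sqrt 5 + e \<and> of_int b * sqrt 5 + e < x / S + sqrt 5"
  proof -
    have "(x / S - e) / sqrt 5 \<le> of_int b" "of_int b < (x / S - e) / sqrt 5 + 1"
      unfolding b_def by linarith+
    then show ?thesis using root(1) by (simp add: field_simps)
  qed
  then have "x / S \<le> of_int b * sqrt 5 + e" "of_int b * sqrt 5 + e < x / S + 3"
    using root by auto
  then have x': "x \<le> x'" "x' \<le> x + 3 * S"
    using S(2) by (simp_all add: x'_def field_simps)
  obtain X where X: "x' \<le> X" "X \<le> x' + 10 * scale ^ J" "\<forall>j<J. in_phase (t j) (d j) (Suc j) X"
    using Suc.IH by blast
  have "X \<le> S * (of_int b * sqrt 5 + e + 1 / 10)"
    using X(2) S(1) by (simp add: x'_def algebra_simps)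
  then have "in_phase (t J) (d J) (Suc J) X"
    unfolding in_phase_def using X(1)
    by (intro exI[of _ b]) (simp add: x'_def e_def S_def add.assoc)
  moreover have "x \<le> X" "X \<le> x + 10 * S" using X x' S by linarith+
  ultimately show ?case
    using X(3) by (intro exI[of _ X]) (simp add: less_Suc_eq S_def)
qed

definition digit_point :: "nat set \<Rightarrow> real" where
  "digit_point A = (\<Sum>m. of_bool (m \<in> A) / scale ^ Suc m)"

text \<open>The tail is at most a geometric series with sum \<open>1 / (scale ^ J * (scale - 1))\<close>.\<close>

lemma digit_point_tail:
  "digit_point A - (\<Sum>m<J. of_bool (m \<in> A) / scale ^ Suc m) \<in> {0..1 / (300 * scale ^ J)}"
proof -
  define f where "f m = of_bool (m \<in> A) / scale ^ Suc m" for m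
  have pos: "0 < scale" "300 < scale" using scale_gt by auto
  have le: "0 \<le> f m" "f m \<le> (1 / scale) * (1 / scale) ^ m" for m
    using pos by (simp_all add: f_def power_divide divide_right_mono)
  have geo: "(\<lambda>m. c * (1 / scale) ^ m) sums (c * (1 / (1 - 1 / scale)))" for c
    using pos by (intro sums_mult geometric_sums) simp
  have f: "summable f"
    by (rule summable_comparison_test[OF _ sums_summable[OF geo[of "1 / scale"]]])
      (use le in \<open>auto intro!: exI[of _ 0]\<close>)
  have "digit_point A = suminf f" unfolding digit_point_def f_def ..
  then have eq: "digit_point A - (\<Sum>m<J. f m) = (\<Sum>m. f (m + J))"
    using suminf_split_initial_segment[OF f, of J] by simp
  have sJ: "summable (\<lambda>m. f (m + J))" using f by simp
  have "(\<Sum>m. f (m + J)) \<le> (1 / scale ^ Suc J) * (1 / (1 - 1 / scale))"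
  proof (rule sums_le[OF _ summable_sums[OF sJ] geo])
    show "f (m + J) \<le> (1 / scale ^ Suc J) * (1 / scale) ^ m" for m
      using le(2)[of "m + J"] by (simp add: power_add power_divide mult_ac)
  qed
  also have "\<dots> = 1 / (scale ^ J * (scale - 1))" using pos by (simp add: field_simps)
  also have "\<dots> \<le> 1 / (scale ^ J * 300)"
  proof (intro divide_left_mono mult_left_mono)
    show "300 \<le> scale - 1" using tau_bounds by (simp add: scale_eq)
  qed (use pos in auto)
  finally have "(\<Sum>m. f (m + J)) \<le> 1 / (300 * scale ^ J)" by (simp add: mult.commute)
  moreover have "0 \<le> (\<Sum>m. f (m + J))" using le by (intro suminf_nonneg sJ)
  ultimately show ?thesis using eq by (simp add: f_def)
qed

text \<open>
  The digits of \<open>A\<close> are replaced by those of \<open>B\<close> one at a time. A digit \<open>1\<close> that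
  becomes \<open>0\<close> moves the window down, and a digit \<open>0\<close> that becomes \<open>1\<close> moves it up; the phases
  of \<open>X\<close> and \<open>Y\<close> at that scale are chosen such that the count drops by one in both cases. What remains
  after \<open>J\<close> digits is a shift so small compared with \<open>Y - X\<close> that it gains and loses at most one point.
\<close>

lemma window_count_digit_points:
  "\<exists>X Y. X \<le> Y \<and> real (card {m. m < J \<and> (m \<in> A) \<noteq> (m \<in> B)}) - 1
      \<le> real (window_count X Y (digit_point A)) - real (window_count X Y (digit_point B))"
proof -
  define a where "a m = (of_bool (m \<in> A) :: real) / scale ^ Suc m" for m
  define b where "b m = (of_bool (m \<in> B) :: real) / scale ^ Suc m" for m
  \<comment> \<open>\<open>u j\<close> has the first \<open>j\<close> digits of \<open>B\<close> and the others of \<open>A\<close>; where the digits at \<open>j\<close>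
    differ, \<open>d j\<close> is the smaller one of \<open>u j\<close> and \<open>u (Suc j)\<close>.\<close>
  define u where "u j = (\<Sum>m<j. b m) + (digit_point A - (\<Sum>m<j. a m))" for j
  define d where "d j = (if j \<in> A then u (Suc j) else u j)" for j
  define t where "t j = (if j \<in> A then 1 else 212 / 100 :: real)" for j
  define t' where "t' j = (if j \<in> A then 212 / 100 else 1 :: real)" for j
  have pos: "0 < scale ^ j" for j using scale_gt by simp
  obtain X where X: "0 \<le> X" "X \<le> 10 * scale ^ J" "\<forall>j<J. in_phase (t j) (d j) (Suc j) X"
    using simultaneous_phases[of 0 J t d] by auto
  obtain Y where Y: "10 * scale ^ J \<le> Y" "Y \<le> 20 * scale ^ J" "\<forall>j<J. in_phase (t' j) (d j) (Suc j) Y"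
    using simultaneous_phases[of "10 * scale ^ J" J t' d] by auto
  have XY: "X \<le> Y" using X Y by linarith
  have step: "real (window_count X Y (u j)) - real (window_count X Y (u (Suc j)))
      = of_bool ((j \<in> A) \<noteq> (j \<in> B))" if "j < J" for j
  proof -
    define h where "h = 1 / scale ^ Suc j"
    have "scale ^ 1 \<le> scale ^ Suc j" using scale_gt by (intro power_increasing) auto
    then have "300 < scale ^ Suc j" using scale_gt unfolding power_one_right by linarith
    then have "0 \<le> h" "h \<le> 1 / 300" by (simp_all add: h_def field_simps del: power_Suc)
    then have h: "0 \<le> h" "h \<le> tau / 2" using tau_bounds by linarith+
    have us: "u j = u (Suc j) + a j - b j" by (simp add: u_def)
    note jump = strip_count_jump[of "Suc j" X Y "d j", OF _ XY, folded h_def]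
    note shift = window_count_shift[OF h, of X Y]
    consider "(j \<in> A) = (j \<in> B)" | "j \<in> A" "j \<notin> B" | "j \<notin> A" "j \<in> B" by blast
    then show ?thesis
    proof cases
      case 1
      then have "u j = u (Suc j)" using us by (simp add: a_def b_def)
      then show ?thesis using 1 by simp
    next
      case 2
      then have "u j = u (Suc j) + h" using us by (simp add: a_def b_def h_def)
      moreover have "t j = 1" "t' j = 212 / 100" "d j = u (Suc j)"
        using 2 by (simp_all add: t_def t'_def d_def)
      moreover from this have "in_phase 1 (d j) (Suc j) X" "in_phase (212 / 100) (d j) (Suc j) Y"
        using X(3) Y(3) that by metis+
      ultimately show ?thesis
        using 2 shift[of "u (Suc j)"] jump(1)[OF zero_less_Suc] by simp
    next
      case 3
      then have "u (Suc j) = u j + h" using us by (simp add: a_def b_def h_def)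
      moreover have "t j = 212 / 100" "t' j = 1" "d j = u j"
        using 3 by (simp_all add: t_def t'_def d_def)
      moreover from this have "in_phase (212 / 100) (d j) (Suc j) X" "in_phase 1 (d j) (Suc j) Y"
        using X(3) Y(3) that by metis+
      ultimately show ?thesis
        using 3 shift[of "u j"] jump(2)[OF zero_less_Suc] by simp
    qed
  qed
  have "real (window_count X Y (u 0)) - real (window_count X Y (u J))
      = (\<Sum>j<J. real (window_count X Y (u j)) - real (window_count X Y (u (Suc j))))"
    using sum_lessThan_telescope'[of "\<lambda>j. real (window_count X Y (u j))" J] by simp
  also have "\<dots> = (\<Sum>j<J. of_bool ((j \<in> A) \<noteq> (j \<in> B)))" using step by (intro sum.cong) auto
  also have "\<dots> = real (card {m. m < J \<and> (m \<in> A) \<noteq> (m \<in> B)})"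
    by (subst sum_of_bool_eq) (auto intro!: arg_cong[of _ _ card])
  finally have main: "real (window_count X Y (digit_point A)) - real (window_count X Y (u J))
      = real (card {m. m < J \<and> (m \<in> A) \<noteq> (m \<in> B)})"
    by (simp add: u_def)
  have "\<bar>u J - digit_point B\<bar> \<le> 1 / (300 * scale ^ J)"
    using digit_point_tail[of A J] digit_point_tail[of B J]
    unfolding u_def a_def b_def atLeastAtMost_iff by linarith
  moreover have "1 / (300 * scale ^ J) \<le> tau / 2"
  proof -
    have "1 \<le> scale ^ J" using scale_gt by (intro one_le_power) auto
    then have "1 / (300 * scale ^ J) \<le> 1 / 2" by (simp add: field_simps)
    then show ?thesis using tau_bounds by linarith
  qed
  moreover have "(Y - X) * \<bar>u J - digit_point B\<bar> < 1"
  proof -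
    have "(Y - X) * \<bar>u J - digit_point B\<bar> \<le> (20 * scale ^ J) * (1 / (300 * scale ^ J))"
      using X Y calculation pos[of J] by (intro mult_mono) auto
    also have "\<dots> < 1" using pos[of J] by simp
    finally show ?thesis .
  qed
  ultimately have "\<bar>real (window_count X Y (u J)) - real (window_count X Y (digit_point B))\<bar> \<le> 1"
    by (intro window_count_near) auto
  then show ?thesis using main XY by (intro exI[of _ X] exI[of _ Y]) linarith
qed

section \<open>Counts of bounded distance equivalent sets\<close>

definition unit_separated :: "real set \<Rightarrow> bool" where
  "unit_separated L \<longleftrightarrow> (\<forall>x\<in>L. \<forall>y\<in>L. x \<noteq> y \<longrightarrow> 1 \<le> \<bar>x - y\<bar>)"

text \<open>Taking integer parts is injective on a unit separated set.\<close>

lemma unit_separated_card: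
  assumes "unit_separated L"
  shows "finite (L \<inter> {X..<Y})" "X \<le> Y \<Longrightarrow> real (card (L \<inter> {X..<Y})) \<le> Y - X + 2"
proof -
  have inj: "inj_on floor (L \<inter> {X..<Y})"
  proof (rule inj_onI, rule ccontr)
    fix x y assume "x \<in> L \<inter> {X..<Y}" "y \<in> L \<inter> {X..<Y}" "\<lfloor>x\<rfloor> = \<lfloor>y\<rfloor>" "x \<noteq> y"
    then have "1 \<le> \<bar>x - y\<bar>" "\<lfloor>x\<rfloor> = \<lfloor>y\<rfloor>" using assms unfolding unit_separated_def by blast+
    then show False by linarith
  qed
  have sub: "floor ` (L \<inter> {X..<Y}) \<subseteq> {\<lfloor>X\<rfloor>..\<lfloor>Y\<rfloor>}" by (fastforce intro: floor_mono)
  show "finite (L \<inter> {X..<Y})"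
    by (rule finite_imageD[OF finite_subset[OF sub] inj]) simp
  assume "X \<le> Y"
  have "card (L \<inter> {X..<Y}) \<le> card {\<lfloor>X\<rfloor>..\<lfloor>Y\<rfloor>}"
    using inj sub by (intro card_inj_on_le) auto
  then show "real (card (L \<inter> {X..<Y})) \<le> Y - X + 2" using \<open>X \<le> Y\<close> by simp linarith
qed

text \<open>
  A bijection that moves points by at most \<open>C\<close> sends the points in \<open>[X, Y)\<close> into a neighbourhood
  of this interval, and the two margins hold a bounded number of points.
\<close>

lemma bd_equivalent_card_le:
  assumes "bd_equivalent L L'" "unit_separated L'"
  obtains K where "\<And>X Y. X \<le> Y \<Longrightarrow>
    real (card (L \<inter> {X..<Y})) \<le> real (card (L' \<inter> {X..<Y})) + K"
proof -
  obtain \<phi> C where \<phi>: "bij_betw \<phi> L L'" "\<forall>x\<in>L. \<bar>x - \<phi> x\<bar> \<le> C"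
    using assms(1) unfolding bd_equivalent_def by blast
  define D where "D = \<bar>C\<bar> + 1"
  have D: "0 \<le> D" by (simp add: D_def)
  note fin = unit_separated_card(1)[OF assms(2)]
  show ?thesis
  proof (rule that[of "2 * (D + 2)"])
    fix X Y :: real assume "X \<le> Y"
    have "\<phi> ` (L \<inter> {X..<Y}) \<subseteq> L' \<inter> {X - D..<X} \<union> L' \<inter> {X..<Y} \<union> L' \<inter> {Y..<Y + D}"
    proof (rule image_subsetI)
      fix x assume x: "x \<in> L \<inter> {X..<Y}"
      have "\<bar>x - \<phi> x\<bar> \<le> C" using \<phi>(2) x by blast
      then have "X - D \<le> \<phi> x" "\<phi> x < Y + D" using x by (simp_all add: D_def) linarith+
      moreover have "\<phi> x \<in> L'" using bij_betwE[OF \<phi>(1)] x by blast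
      ultimately show "\<phi> x \<in> L' \<inter> {X - D..<X} \<union> L' \<inter> {X..<Y} \<union> L' \<inter> {Y..<Y + D}"
        by simp linarith
    qed
    moreover have "inj_on \<phi> (L \<inter> {X..<Y})"
      by (rule inj_on_subset[OF bij_betw_imp_inj_on[OF \<phi>(1)] Int_lower1])
    ultimately have "card (L \<inter> {X..<Y})
        \<le> card (L' \<inter> {X - D..<X} \<union> L' \<inter> {X..<Y} \<union> L' \<inter> {Y..<Y + D})"
      using fin by (intro card_inj_on_le[of \<phi>]) auto
    also have "\<dots> \<le> card (L' \<inter> {X - D..<X}) + card (L' \<inter> {X..<Y}) + card (L' \<inter> {Y..<Y + D})"
      by (rule order_trans[OF card_Un_le add_right_mono[OF card_Un_le]])
    finally show "real (card (L \<inter> {X..<Y})) \<le> real (card (L' \<inter> {X..<Y})) + 2 * (D + 2)"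
      using unit_separated_card(2)[OF assms(2), of "X - D" X]
        unit_separated_card(2)[OF assms(2), of Y "Y + D"] D by simp
  qed
qed

section \<open>Shifted half windows in the hull\<close>

definition half_window_set :: "real \<Rightarrow> real set" where
  "half_window_set u = cut_and_project {u..<u + tau / 2}"

lemma mem_half_window_set:
  "x \<in> half_window_set u \<longleftrightarrow> x \<in> Z_tau \<and> u \<le> conj_tau x \<and> conj_tau x < u + tau / 2"
  by (auto simp: half_window_set_def cut_and_project_def)

lemma window_count_eq_card: "window_count X Y u = card (half_window_set u \<inter> {X..<Y})"
  unfolding window_count_def strip_count_def
  by (rule arg_cong[where f = card]) (auto simp: mem_half_window_set)

text \<open>
  The window is shorter than \<open>1\<close>, so conjugates of points differ by less than \<open>1\<close>, and the norm
  forces the points themselves apart.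
\<close>

lemma unit_separated_half_window_set: "unit_separated (half_window_set u)"
  unfolding unit_separated_def
proof (intro ballI impI, rule ccontr)
  fix x y assume x: "x \<in> half_window_set u" and y: "y \<in> half_window_set u"
    and ne: "x \<noteq> y" "\<not> 1 \<le> \<bar>x - y\<bar>"
  have Z: "x \<in> Z_tau" "y \<in> Z_tau" using x y by (simp_all only: mem_half_window_set)
  have "\<bar>conj_tau x - conj_tau y\<bar> < 1"
    using x y tau_bounds(2) unfolding mem_half_window_set by linarith
  then have "\<bar>x - y\<bar> * \<bar>conj_tau x - conj_tau y\<bar> < 1 * 1"
    using ne(2) by (intro mult_strict_mono') linarith+
  then show False using Z_tau_eqI[OF Z] ne(1) by simp
qed

lemma translate_half_fibonacci:
  assumes y: "y \<in> Z_tau"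
  shows "translate half_fibonacci y = half_window_set (- 1 - conj_tau y)"
proof -
  have "x + y \<in> Z_tau \<longleftrightarrow> x \<in> Z_tau" for x
    using Z_tau_diff(1)[of "x + y" y] Z_tau_add(1)[of x y] y by force
  moreover have "conj_tau (x + y) = conj_tau x + conj_tau y" if "x \<in> Z_tau" for x
    using Z_tau_add(2)[OF that y] .
  ultimately have "x + y \<in> half_fibonacci \<longleftrightarrow> x \<in> half_window_set (- 1 - conj_tau y)" for x
    unfolding half_fibonacci_def cut_and_project_def mem_half_window_set mem_Collect_eq atLeastLessThan_iff
    by smt
  then show ?thesis unfolding set_eq_iff mem_translate by blast
qed

text \<open>
  Relative density already holds for the points of a single strip of height \<open>1 / scale\<close>, which fits
  into the window.
\<close>

lemma delone_half_window_set: "delone (half_window_set u)"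
proof -
  obtain p where p: "{x \<in> Z_tau. u \<le> conj_tau x \<and> conj_tau x < u + 1 / scale ^ 1} = range p"
    "\<And>b. scale ^ 1 * (of_int b * sqrt 5 + scale ^ 1 * u) \<le> p b"
    "\<And>b. p b < scale ^ 1 * (of_int b * sqrt 5 + scale ^ 1 * u + 1)"
    by (rule strip_enumeration[of u 1]) (rule that)
  have root: "0 < sqrt 5" "sqrt 5 < 3" unfolding sqrt5_eq using tau_bounds by auto
  have "1 / scale < 1 / 300" using scale_gt by (simp add: field_simps)
  then have "1 / scale < tau / 2" using tau_bounds by linarith
  then have "{x \<in> Z_tau. u \<le> conj_tau x \<and> conj_tau x < u + 1 / scale ^ 1} \<subseteq> half_window_set u"
    by (auto simp: mem_half_window_set)
  then have sub: "p b \<in> half_window_set u" for b unfolding p(1) by blast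
  have dense: "half_window_set u \<inter> cball c (4 * scale) \<noteq> {}" for c
  proof -
    define b where "b = \<lceil>(c / scale - scale * u) / sqrt 5\<rceil>"
    have "(c / scale - scale * u) / sqrt 5 \<le> of_int b"
      "of_int b < (c / scale - scale * u) / sqrt 5 + 1"
      unfolding b_def by linarith+
    then have "c / scale \<le> of_int b * sqrt 5 + scale * u"
      "of_int b * sqrt 5 + scale * u < c / scale + sqrt 5"
      using root(1) by (simp_all add: field_simps)
    then have "c / scale \<le> of_int b * sqrt 5 + scale * u"
      "of_int b * sqrt 5 + scale * u + 1 \<le> c / scale + 4"
      using root by auto
    then have "scale * (c / scale) \<le> scale * (of_int b * sqrt 5 + scale * u)"
      "scale * (of_int b * sqrt 5 + scale * u + 1) \<le> scale * (c / scale + 4)"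
      by (simp_all only: mult_le_cancel_left_pos[OF scale_pos(1)])
    moreover have "scale * (c / scale) = c" "scale * (c / scale + 4) = c + 4 * scale"
      by (simp_all add: algebra_simps)
    ultimately have "c \<le> p b" "p b \<le> c + 4 * scale" using p(2,3)[of b] by simp_all
    then have "p b \<in> cball c (4 * scale)" by (simp add: dist_real_def)
    then show ?thesis using sub by blast
  qed
  have sparse: "x = y"
    if "x \<in> half_window_set u \<inter> ball c (1 / 2)" "y \<in> half_window_set u \<inter> ball c (1 / 2)" for c x y
  proof (rule ccontr)
    assume "x \<noteq> y"
    then have "1 \<le> \<bar>x - y\<bar>"
      using that unit_separated_half_window_set[of u] unfolding unit_separated_def by blast
    moreover have "dist c x < 1 / 2" "dist c y < 1 / 2" using that by simp_all
    ultimately show False unfolding dist_real_def by linarith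
  qed
  have "\<forall>c. \<forall>x\<in>half_window_set u \<inter> ball c (1 / 2). \<forall>y\<in>half_window_set u \<inter> ball c (1 / 2). x = y"
    using sparse by blast
  moreover have "\<forall>c. half_window_set u \<inter> cball c (4 * scale) \<noteq> {}" using dense by blast
  moreover have "0 < 4 * scale" "0 < (1 / 2 :: real)" by simp_all
  ultimately show ?thesis unfolding delone_def by blast
qed

lemma conj_tau_dense:
  assumes "v < w"
  obtains y where "y \<in> Z_tau" "v \<le> conj_tau y" "conj_tau y < w"
proof -
  obtain m where m: "(1 / scale) ^ m < w - v"
    using real_arch_pow_inv[of "w - v" "1 / scale"] assms scale_gt by auto
  obtain p :: "int \<Rightarrow> real"
    where p: "{x \<in> Z_tau. v \<le> conj_tau x \<and> conj_tau x < v + 1 / scale ^ m} = range p"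
    by (rule strip_enumeration[of v m]) (rule that)
  then have "p 0 \<in> {x \<in> Z_tau. v \<le> conj_tau x \<and> conj_tau x < v + 1 / scale ^ m}" by blast
  then show ?thesis using m by (intro that[of "p 0"]) (auto simp: power_divide)
qed

text \<open>
  Only finitely many conjugates matter on the given ball. If the window is moved slightly downwards,
  neither end passes one of them; the direction matters because the window contains its lower
  end but not its upper one.
\<close>

lemma half_window_set_close:
  assumes "0 < \<epsilon>"
  obtains y where "y \<in> Z_tau" "close_within (half_window_set u) (translate half_fibonacci y) \<epsilon>"
proof -
  define F where "F = conj_tau ` {x \<in> Z_tau. \<bar>x\<bar> \<le> 1 / \<epsilon> \<and> \<bar>conj_tau x\<bar> \<le> \<bar>u\<bar> + 3}"
  have F: "finite F" unfolding F_def by (intro finite_imageI finite_Z_tau_box)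
  obtain d where d: "0 < d" "\<forall>x\<in>F. x \<noteq> u \<longrightarrow> d \<le> dist u x"
    using finite_set_avoid[OF F, of u] by blast
  obtain d' where d': "0 < d'" "\<forall>x\<in>F. x \<noteq> u + tau / 2 \<longrightarrow> d' \<le> dist (u + tau / 2) x"
    using finite_set_avoid[OF F, of "u + tau / 2"] by blast
  define \<delta> where "\<delta> = min 1 (min d d')"
  have \<delta>: "0 < \<delta>" "\<delta> \<le> 1" "\<delta> \<le> d" "\<delta> \<le> d'" using d d' by (auto simp: \<delta>_def)
  obtain y where y: "y \<in> Z_tau" "- 1 - u \<le> conj_tau y" "conj_tau y < - 1 - u + \<delta>"
    using conj_tau_dense[of "- 1 - u" "- 1 - u + \<delta>"] \<delta>(1) by auto
  define v where "v = - 1 - conj_tau y"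
  have v: "u - \<delta> < v" "v \<le> u" using y by (auto simp: v_def)
  have "x \<in> half_window_set u \<longleftrightarrow> x \<in> half_window_set v" if x: "\<bar>x\<bar> \<le> 1 / \<epsilon>" for x
  proof (cases "x \<in> Z_tau")
    case True
    have "\<not> (v \<le> conj_tau x \<and> conj_tau x < u)"
    proof
      assume c: "v \<le> conj_tau x \<and> conj_tau x < u"
      then have "\<bar>conj_tau x\<bar> \<le> \<bar>u\<bar> + 3" using v \<delta> by linarith
      then have "conj_tau x \<in> F" using True x unfolding F_def by blast
      then show False using d(2) c v \<delta> by (fastforce simp: dist_real_def)
    qed
    moreover have "\<not> (v + tau / 2 \<le> conj_tau x \<and> conj_tau x < u + tau / 2)"
    proof
      assume c: "v + tau / 2 \<le> conj_tau x \<and> conj_tau x < u + tau / 2"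
      then have "\<bar>conj_tau x\<bar> \<le> \<bar>u\<bar> + 3" using v \<delta> tau_bounds by linarith
      then have "conj_tau x \<in> F" using True x unfolding F_def by blast
      then show False using d'(2) c v \<delta> by (fastforce simp: dist_real_def)
    qed
    ultimately show ?thesis using True v(2) unfolding mem_half_window_set by linarith
  qed (simp add: mem_half_window_set)
  then have "half_window_set u \<inter> cball 0 (1 / \<epsilon>) = half_window_set v \<inter> cball 0 (1 / \<epsilon>)" by auto
  then have "close_within (half_window_set u) (translate half_fibonacci y) \<epsilon>"
    unfolding close_within_def translate_half_fibonacci[OF y(1)] v_def[symmetric]
    using assms by (intro exI[of _ 0]) (simp add: translate_def)
  then show ?thesis using y(1) that by blast
qed

lemma half_window_set_in_hull: "half_window_set u \<in> delone_hull half_fibonacci"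
  unfolding delone_hull_def Metric_space.metric_closure_of[OF Metric_space_delone] mem_Collect_eq
proof (intro conjI allI impI)
  fix r :: real assume r: "0 < r"
  define \<epsilon> where "\<epsilon> = min (1 / 2) (r / 2)"
  have \<epsilon>: "0 < \<epsilon>" "\<epsilon> < 1" "\<epsilon> < r" using r by (auto simp: \<epsilon>_def)
  obtain y where y: "y \<in> Z_tau" "close_within (half_window_set u) (translate half_fibonacci y) \<epsilon>"
    using half_window_set_close[OF \<epsilon>(1)] by blast
  have "delone_dist (half_window_set u) (translate half_fibonacci y) < r"
    using delone_dist_le[OF y(2) \<epsilon>(1,2)] \<epsilon>(3) by linarith
  moreover have "delone (translate half_fibonacci y)"
    unfolding translate_half_fibonacci[OF y(1)] by (rule delone_half_window_set)
  ultimately show "\<exists>T\<in>range (translate half_fibonacci).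
      T \<in> Metric_space.mball (Collect delone) delone_dist (half_window_set u) r"
    by (auto simp: Metric_space.in_mball[OF Metric_space_delone] delone_half_window_set)
qed (rule delone_half_window_set)

section \<open>Uncountably many classes\<close>

lemma bd_equivalent_digit_points:
  assumes "bd_equivalent (half_window_set (digit_point A)) (half_window_set (digit_point B))"
  shows "finite {m. (m \<in> A) \<noteq> (m \<in> B)}"
proof (rule ccontr)
  assume inf: "infinite {m. (m \<in> A) \<noteq> (m \<in> B)}"
  obtain K where K: "\<And>X Y. X \<le> Y \<Longrightarrow>
      real (window_count X Y (digit_point A)) \<le> real (window_count X Y (digit_point B)) + K"
    using bd_equivalent_card_le[OF assms unit_separated_half_window_set]
    unfolding window_count_eq_card by blast
  obtain n :: nat where n: "K + 1 < real n" using reals_Archimedean2 by blast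
  obtain T where T: "T \<subseteq> {m. (m \<in> A) \<noteq> (m \<in> B)}" "card T = n" "finite T"
    using infinite_arbitrarily_large[OF inf, of n] by blast
  obtain J where J: "T \<subseteq> {..<J}" using finite_nat_bounded[OF T(3)] by blast
  have "n \<le> card {m. m < J \<and> (m \<in> A) \<noteq> (m \<in> B)}"
    unfolding T(2)[symmetric] using T(1) J by (intro card_mono) auto
  then show False using window_count_digit_points[of J A B] K n by fastforce
qed

theorem corollary1p2:
  shows "uncountable (delone_hull half_fibonacci // bd_rel (delone_hull half_fibonacci))"
proof
  define H where "H = delone_hull half_fibonacci"
  \<comment> \<open>Each membership is copied to infinitely many digits, so that distinct sets
    have digits that differ infinitely often.\<close>
  define stretch :: "nat set \<Rightarrow> nat set" where "stretch A = {m. fst (prod_decode m) \<in> A}" for A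
  define point where "point A = half_window_set (digit_point (stretch A))" for A
  define cls where "cls A = bd_rel H `` {point A}" for A
  have hull: "point A \<in> H" for A
    unfolding H_def point_def by (rule half_window_set_in_hull)
  have inj: "inj cls"
  proof (rule injI, rule ccontr)
    fix A B assume "cls A = cls B" "A \<noteq> B"
    then have "(point A, point B) \<in> bd_rel H"
      using eq_equiv_class[OF _ equiv_bd_rel hull] unfolding cls_def by blast
    then have "bd_equivalent (point A) (point B)" by (simp add: bd_rel_def)
    then have fin: "finite {m. (m \<in> stretch A) \<noteq> (m \<in> stretch B)}"
      unfolding point_def by (rule bd_equivalent_digit_points)
    obtain a where a: "(a \<in> A) \<noteq> (a \<in> B)" using \<open>A \<noteq> B\<close> by blast
    have "range (\<lambda>k. prod_encode (a, k)) \<subseteq> {m. (m \<in> stretch A) \<noteq> (m \<in> stretch B)}"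
      using a by (auto simp: stretch_def)
    moreover have "infinite (range (\<lambda>k. prod_encode (a, k)))"
      by (rule range_inj_infinite) (auto intro: injI)
    ultimately show False using fin finite_subset by blast
  qed
  assume "countable (delone_hull half_fibonacci // bd_rel (delone_hull half_fibonacci))"
  moreover have "range cls \<subseteq> H // bd_rel H" unfolding cls_def using hull by (auto intro: quotientI)
  ultimately have "countable (range cls)" unfolding H_def using countable_subset by blast
  then have "countable (UNIV :: nat set set)" using inj by (simp add: countable_image_inj_eq)
  then obtain f :: "nat \<Rightarrow> nat set" where "range f = UNIV"
    using uncountable_def by (metis UNIV_not_empty)
  then show False using Cantors_theorem[of "UNIV :: nat set"] by auto
qed

end
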